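(* Let $q=3^m$ with $m\geq 1$ an integer, let $c\in\mathbb{F}_q^{\ast}$ and $d\in\mathbb{F}_q$, and put $g(x)=x^3-dx-c^2$ and $h(x)=x^4+cx+d$. Then the following hold. 1. $h(x)$ splits completely into linear factors over $\mathbb{F}_q$ if and only if $g(r_j^2)=0$ $(1\le j\le 3)$ for some pairwise distinct $r_1,r_2,r_3\in\mathbb{F}_q$ such that $-r_j^2\pm cr_j^{-1}$ $(1\le j\le 3)$ are squares in $\mathbb{F}_q$. 2. $h(x)$ is factored as a product of two irreducible quadratic factors over $\mathbb{F}_q$ if and only if $g(u_j)=0$ $(1\le j\le 3)$ for some pairwise distinct $u_1,u_2,u_3\in\mathbb{F}_q$ such that $u_1,u_2$ are non-squares in $\mathbb{F}_q$ and $u_3=r^2$ for some $r\in\mathbb{F}_q$, where $-r^2\pm cr^{-1}$ are non-squares in $\mathbb{F}_q$. 3. $h(x)$ has a unique root in $\mathbb{F}_q$ if and only if $g(x)$ is irreducible over $\mathbb{F}_q$. 4. $h(x)$ has exactly two roots in $\mathbb{F}_q$ if and only if $g(x)$ has a unique root $r^2\in\mathbb{F}_q$, where $r\in\mathbb{F}_q$ and $r^4-c^2r^{-2}$ is a non-square in $\mathbb{F}_q$. 5. $h(x)$ is irreducible over $\mathbb{F}_q$ if and only if $g(x)$ has a unique root in $\mathbb{F}_q$, and this root is a non-square in $\mathbb{F}_q$.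
   Context: $\mathbb{F}_q$ is the finite field with $q$ elements and $\mathbb{F}_q^{\ast}$ its set of nonzero elements. A square in $\mathbb{F}_q$ is an element of the form $s^2$ with $s\in\mathbb{F}_q$; a non-square is an element of $\mathbb{F}_q$ that is not a square. The notation $-r^2\pm cr^{-1}$ refers to both elements $-r^2+cr^{-1}$ and $-r^2-cr^{-1}$. Since $g(0)=-c^2\neq 0$, any $r\in\mathbb{F}_q$ with $g(r^2)=0$ is nonzero, so the inverses appearing in the statement make sense.
   Formalization: In item 1, "splits completely" means into pairwise distinct linear factors, and in item 4 roots are counted with multiplicity; this matters only for d=0, where h=x(x+a)^3 with a^3=c makes items 1 and 4 false as literally read. *)

theory Defs
  imports "HOL-Computational_Algebra.Computational_Algebra"
    "HOL-Library.Cardinality"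
begin

definition cubic_g :: "'a::field \<Rightarrow> 'a \<Rightarrow> 'a poly" where
  "cubic_g c d = [:- (c ^ 2), - d, 0, 1:]"

definition quartic_h :: "'a::field \<Rightarrow> 'a \<Rightarrow> 'a poly" where
  "quartic_h c d = [:d, c, 0, 0, 1:]"

text \<open>
  Over a field of characteristic 3 the quartic $x^4 + cx + d$ with $d \ne 0$ has no repeated root,
  whereas $x^4 + cx = x (x + a)^3$ if $c = a^3$, and then $x^3 - c^2 = (x - a^2)^3$ has only one
  root. For $d = 0$ the quartic must therefore count neither as splitting completely nor as having
  exactly two roots. So a polynomial splits completely if it is a product of pairwise distinct
  linear factors, and the number of its roots is that with multiplicities, i.e. the size of
  \<^const>\<open>proots\<close>. The lemmas below show that neither convention matters if $d \ne 0$.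
\<close>

definition splits_into_distinct_linear_factors :: "'a::field poly \<Rightarrow> bool" where
  "splits_into_distinct_linear_factors p \<longleftrightarrow>
     (\<exists>A. finite A \<and> p = smult (lead_coeff p) (\<Prod>a\<in>A. [:- a, 1:]))"

lemma splits_into_distinct_linear_factors_iff_if_rsquarefree:
  fixes p :: "'a::field poly"
  assumes "rsquarefree p"
  shows "splits_into_distinct_linear_factors p \<longleftrightarrow>
           (\<exists>as. p = smult (lead_coeff p) (\<Prod>a\<leftarrow>as. [:- a, 1:]))"
proof
  assume "splits_into_distinct_linear_factors p"
  then obtain A where A: "finite A" "p = smult (lead_coeff p) (\<Prod>a\<in>A. [:- a, 1:])"
    unfolding splits_into_distinct_linear_factors_def by blast
  obtain as where "set as = A" "distinct as"
    using finite_distinct_list[OF A(1)] by blast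
  then have "(\<Prod>a\<in>A. [:- a, 1:]) = (\<Prod>a\<leftarrow>as. [:- a, 1:])"
    by (metis prod.distinct_set_conv_list)
  with A(2) have "p = smult (lead_coeff p) (\<Prod>a\<leftarrow>as. [:- a, 1:])" by (simp only:)
  then show "\<exists>as. p = smult (lead_coeff p) (\<Prod>a\<leftarrow>as. [:- a, 1:])" by (rule exI)
next
  assume "\<exists>as. p = smult (lead_coeff p) (\<Prod>a\<leftarrow>as. [:- a, 1:])"
  then obtain as where as: "p = smult (lead_coeff p) (\<Prod>a\<leftarrow>as. [:- a, 1:])" by blast
  have nz: "p \<noteq> 0" using assms by (simp add: rsquarefree_def)
  have "proots p = proots (smult (lead_coeff p) (\<Prod>a\<leftarrow>as. [:- a, 1:]))"
    by (rule arg_cong[OF as])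
  also have "\<dots> = proots (\<Prod>a\<leftarrow>as. [:- a, 1:])" using nz by (intro proots_smult) simp
  also have "\<dots> = mset as"
  proof (induction as)
    case (Cons a as)
    have "(\<Prod>a\<leftarrow>as. [:- a, 1:]) \<noteq> 0" by (auto simp: prod_list_zero_iff)
    with Cons show ?case by (simp add: proots_mult del: mult_pCons_left)
  qed simp
  finally have pr: "proots p = mset as" .
  have "count (mset as) a \<le> 1" for a
    using assms nz by (metis pr count_proots rsquarefree_def le_numeral_extra(4) zero_le_one)
  then have "distinct as"
    by (auto simp: distinct_count_atmost_1 intro!: antisym)
  then have "(\<Prod>a\<leftarrow>as. [:- a, 1:]) = (\<Prod>a\<in>set as. [:- a, 1:])"
    by (metis prod.distinct_set_conv_list)
  with as have "p = smult (lead_coeff p) (\<Prod>a\<in>set as. [:- a, 1:])" by (simp only:)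
  then show "splits_into_distinct_linear_factors p"
    unfolding splits_into_distinct_linear_factors_def by blast
qed

lemma size_proots_if_rsquarefree:
  fixes p :: "'a::field poly"
  assumes "rsquarefree p"
  shows "size (proots p) = card {x. poly p x = 0}"
proof -
  have nz: "p \<noteq> 0" using assms by (simp add: rsquarefree_def)
  have "count (proots p) x = 1" if "poly p x = 0" for x
    using assms nz that by (metis count_proots order_root rsquarefree_def)
  with nz show ?thesis by (simp add: size_multiset_overloaded_eq)
qed

lemma rsquarefree_quartic_h:
  fixes c d :: "'a::{field, finite}"
  assumes "CARD('a) = 3 ^ m" and "d \<noteq> 0"
  shows "rsquarefree (quartic_h c d)"
proof -
  have "of_nat CARD('a) = (0 :: 'a)"
  proof -
    have "(\<Sum>x\<in>UNIV. x + 1) = (\<Sum>x\<in>UNIV. x :: 'a)"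
      by (rule sum.reindex_bij_witness[of _ "\<lambda>x. x - 1" "\<lambda>x. x + 1"]) auto
    then show ?thesis by (simp add: sum.distrib)
  qed
  then have three: "(3 :: 'a) = 0"
    by (simp add: assms(1))
  have "(4 :: 'a) = 3 + 1" by simp
  with three have four: "(4 :: 'a) = 1" by (simp only: add_0)
  let ?h = "quartic_h c d"
  have deriv: "poly ?h a = a * poly (pderiv ?h) a + d" for a
    by (simp add: quartic_h_def pderiv_pCons algebra_simps four)
  have nz: "?h \<noteq> 0" by (simp add: quartic_h_def)
  have "order a ?h < 2" for a
  proof (rule ccontr)
    assume "\<not> order a ?h < 2"
    then have "[:- a, 1:] ^ 2 dvd ?h" by (simp only: order_divides not_less simp_thms)
    then obtain k where "?h = [:- a, 1:] ^ 2 * k" by (rule dvdE)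
    then have k: "?h = [:- a, 1:] * ([:- a, 1:] * k)"
      by (simp only: power2_eq_square mult.assoc)
    have "poly ?h a = 0" "poly (pderiv ?h) a = 0"
      unfolding k pderiv_mult by simp_all
    with deriv[of a] assms(2) show False by simp
  qed
  with nz show ?thesis
    by (simp add: rsquarefree_def less_2_cases_iff)
qed

end

theory Submission
  imports Defs
begin

text \<open>
  The polynomial $g$ is the cubic resolvent of $h$: distinct roots $a, b$ of $h$ give the root
  $(a + b)^2$ of $g$, and conversely a root $r^2$ of $g$ gives the factorization
  $h = (x^2 + rx + D_2)(x^2 - rx + D_1)$ with $D_1 = -r^2 - cr^{-1}$ and $D_2 = -r^2 + cr^{-1}$.
  In characteristic 3 these two quadratics have discriminants $D_1$ and $D_2$, and $d = D_1 D_2$.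
  If $h$ has a root $a$, then every root of $g$ is a square, because
  $g(u) = u(u - a^2)^2 - (au + c)^2$. The difference of two distinct roots of $g$ is a square root
  of $d$, as $x \mapsto x^3 - dx$ is additive. Together with the fact that the product of two
  non-squares of a finite field is a square, this settles everything except that $h$ has a root
  if $g$ has none. That follows without Galois theory: an injective self-map of a finite set is onto.
\<close>

section \<open>Evaluations, degrees and characteristic 3\<close>

lemma poly_cubic_g: "poly (cubic_g c d) u = u ^ 3 - d * u - c ^ 2"
  by (simp add: cubic_g_def algebra_simps power2_eq_square power3_eq_cube)

lemma poly_quartic_h: "poly (quartic_h c d) x = x ^ 4 + c * x + d"
  by (simp add: quartic_h_def algebra_simps power4_eq_xxxx)

lemma degree_cubic_g: "degree (cubic_g c d) = 3"
  by (simp add: cubic_g_def)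

lemma degree_quartic_h: "degree (quartic_h c d) = 4"
  by (simp add: quartic_h_def)

lemma three_eq_0_if_CARD:
  assumes "CARD('a::{field, finite}) = 3 ^ m"
  shows "(3 :: 'a) = 0"
proof -
  have "(\<Sum>x\<in>UNIV. x + 1) = (\<Sum>x\<in>UNIV. x :: 'a)"
    by (rule sum.reindex_bij_witness[of _ "\<lambda>x. x - 1" "\<lambda>x. x + 1"]) auto
  then have "of_nat CARD('a) = (0 :: 'a)"
    by (simp add: sum.distrib)
  then show ?thesis
    by (simp add: assms)
qed

lemma two_ne_0_if_three_eq_0:
  assumes "(3 :: 'a::field) = 0"
  shows "(2 :: 'a) \<noteq> 0"
proof
  assume "(2 :: 'a) = 0"
  moreover have "(3 :: 'a) = 2 + 1" by simp
  ultimately show False using assms by simp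
qed

section \<open>Squares in a finite field\<close>

text \<open>The nonzero squares have index at most two in the multiplicative group. Counting shows
  this in every characteristic, without using that the group is cyclic.\<close>

lemma is_square_mult_if_nonsquares:
  fixes a b :: "'a::{field, finite}"
  assumes "\<not> is_square a" and "\<not> is_square b"
  shows "is_square (a * b)"
proof (rule ccontr)
  assume ab: "\<not> is_square (a * b)"
  define S where "S = (\<lambda>x :: 'a. x ^ 2) ` (UNIV - {0})"
  have a0: "a \<noteq> 0" and b0: "b \<noteq> 0" using assms by (auto intro: is_nth_powerI[of 0 0])
  have fibre: "card {x \<in> UNIV - {0}. x ^ 2 = s} \<le> 2" for s :: 'a
  proof (cases "\<exists>y. y ^ 2 = s")
    case True
    then obtain y where "y ^ 2 = s" by blast
    then have "{x \<in> UNIV - {0}. x ^ 2 = s} \<subseteq> {y, - y}" by (auto simp: power2_eq_iff)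
    then have "card {x \<in> UNIV - {0}. x ^ 2 = s} \<le> card {y, - y}" by (intro card_mono) auto
    also have "\<dots> \<le> 2" by (simp add: card_insert_if)
    finally show ?thesis .
  qed (auto simp: card_eq_0_iff)
  have "card (UNIV - {0 :: 'a}) = (\<Sum>s\<in>S. card {x \<in> UNIV - {0}. x ^ 2 = s})"
    unfolding S_def card_eq_sum by (rule sum.image_gen) simp
  also have "\<dots> \<le> (\<Sum>s\<in>S. 2)" by (intro sum_mono fibre)
  finally have upper: "card (UNIV - {0 :: 'a}) \<le> 2 * card S" by simp
  \<comment> \<open>$S$, $aS$ and $bS$ are disjoint, which is too much as squaring is at most two-to-one.\<close>
  have ratio: "is_square (x * y)" if eq: "x * s = y * t" and S: "s \<in> S" "t \<in> S" for x y s t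
  proof -
    obtain u v where u: "s = u ^ 2" "u \<noteq> 0" and v: "t = v ^ 2" "v \<noteq> 0"
      using S unfolding S_def by auto
    have x: "x = y * v ^ 2 / u ^ 2" using eq u v by (simp add: field_simps)
    have "x * y = (y * v / u) ^ 2" unfolding x by (simp add: power2_eq_square)
    then show ?thesis by (rule is_nth_powerI)
  qed
  have disj: "(*) x ` S \<inter> (*) y ` S = {}" if "\<not> is_square (x * y)" for x y
    using ratio[of x _ y] that by blast
  have "S \<inter> (*) a ` S = {}" "S \<inter> (*) b ` S = {}" "(*) a ` S \<inter> (*) b ` S = {}"
    using disj[of 1 a] disj[of 1 b] disj[of a b] assms ab by simp_all
  then have "card (S \<union> ((*) a ` S \<union> (*) b ` S)) = 3 * card S"
    using a0 b0 by (simp add: Int_Un_distrib card_Un_disjoint card_image inj_on_def)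
  moreover have "card (S \<union> ((*) a ` S \<union> (*) b ` S)) \<le> card (UNIV - {0 :: 'a})"
    using a0 b0 by (intro card_mono) (auto simp: S_def)
  ultimately have "card S = 0" using upper by linarith
  then have "S = {}" by (simp add: S_def)
  moreover have "1 \<in> S" unfolding S_def by (rule image_eqI[of _ _ 1]) auto
  ultimately show False by blast
qed

section \<open>Relations between roots of the quartic and its resolvent\<close>

text \<open>Subtracting the two equations and dividing by \<open>a - b\<close> yields
  \<open>c\<close>; substituting it back yields \<open>d\<close> up to a multiple of 3. Claims about
  two roots thus become polynomial identities modulo 3 in \<open>a\<close> and
  \<open>b\<close>.\<close>

lemma coeffs_if_two_roots_quartic_h:
  fixes a b c d :: "'a::field"
  assumes "(3 :: 'a) = 0" "a \<noteq> b" "poly (quartic_h c d) a = 0" "poly (quartic_h c d) b = 0"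
  shows "c = - ((a + b) * (a ^ 2 + b ^ 2))" and "d = a * b * (a - b) ^ 2"
proof -
  have "(a - b) * (c + (a + b) * (a ^ 2 + b ^ 2)) = 0"
    using assms(3,4) unfolding poly_quartic_h by algebra
  then show c: "c = - ((a + b) * (a ^ 2 + b ^ 2))"
    using assms(2) by (simp add: eq_neg_iff_add_eq_0)
  have "d = a * b * (a - b) ^ 2 + 3 * (a ^ 2 * b ^ 2)"
    using assms(3) unfolding poly_quartic_h c by algebra
  then show "d = a * b * (a - b) ^ 2" using assms(1) by simp
qed

lemma cubic_g_root_if_two_roots_quartic_h:
  fixes a b c d :: "'a::field"
  assumes "(3 :: 'a) = 0" "a \<noteq> b" "poly (quartic_h c d) a = 0" "poly (quartic_h c d) b = 0"
  shows "poly (cubic_g c d) ((a + b) ^ 2) = 0"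
proof -
  have "poly (cubic_g c d) ((a + b) ^ 2) = 3 * (a * b * (a + b) ^ 4)"
    unfolding poly_cubic_g coeffs_if_two_roots_quartic_h[OF assms] by algebra
  then show ?thesis using assms(1) by simp
qed

text \<open>With \<open>r = a + b\<close>, characteristic 3 gives
  \<open>a * b = - r^2 - c / r\<close>, so \<open>a\<close> and \<open>b\<close> are the roots of
  \<open>x^2 - r x + D_1\<close>; both sides are the discriminant \<open>D_2\<close> of this
  factor.\<close>

lemma discriminant_if_two_roots_quartic_h:
  fixes a b c d :: "'a::field"
  assumes "(3 :: 'a) = 0" "a \<noteq> b" "poly (quartic_h c d) a = 0" "poly (quartic_h c d) b = 0" "c \<noteq> 0"
  shows "- ((a + b) ^ 2) + c * inverse (a + b) = (a - b) ^ 2"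
proof -
  note c = coeffs_if_two_roots_quartic_h(1)[OF assms(1-4)]
  have ab: "a + b \<noteq> 0" using c assms(5) by auto
  have "c * inverse (a + b) = - (a ^ 2 + b ^ 2)" using ab by (simp add: c field_simps)
  then have "- ((a + b) ^ 2) + c * inverse (a + b) = (a - b) ^ 2 - 3 * (a ^ 2 + b ^ 2)"
    by algebra
  then show ?thesis using assms(1) by simp
qed

text \<open>The vanishing coefficient of \<open>x^3\<close>, obtained by three divided differences,
  each of which cancels a nonzero difference of roots.\<close>

lemma sum_roots_quartic_h:
  fixes a b x y c d :: "'a::field"
  assumes "(3 :: 'a) = 0" "distinct [a, b, x, y]"
    and "\<forall>z \<in> {a, b, x, y}. poly (quartic_h c d) z = 0"
  shows "a + b + x + y = 0"
proof -
  have *: "c + (a + z) * (a ^ 2 + z ^ 2) = 0" if "z \<in> {b, x, y}" for z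
    using assms that coeffs_if_two_roots_quartic_h(1)[of a z c d] by auto
  have **: "a * (b + z) + a ^ 2 + b ^ 2 + b * z + z ^ 2 = 0" if "z \<in> {x, y}" for z
  proof -
    have "(b - z) * (a * (b + z) + a ^ 2 + b ^ 2 + b * z + z ^ 2) = 0"
      using *[of b] *[of z] that by simp algebra
    then show ?thesis using assms(2) that by auto
  qed
  have "(x - y) * (a + b + x + y) = 0"
    using **[of x] **[of y] by simp algebra
  then show ?thesis using assms(2) by auto
qed

section \<open>Roots of the cubic\<close>

lemma square_diff_roots_cubic_g:
  fixes u v c d :: "'a::field"
  assumes "(3 :: 'a) = 0" "u \<noteq> v" "poly (cubic_g c d) u = 0" "poly (cubic_g c d) v = 0"
  shows "d = (u - v) ^ 2"
proof -
  have "(u - v) * ((u - v) ^ 2 - d) = - 3 * (u * v * (u - v))"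
    using assms(3,4) unfolding poly_cubic_g by algebra
  then show ?thesis using assms(1,2) by simp
qed

text \<open>\<open>e\<close> lies in the kernel of the additive map \<open>x^3 - e^2 x\<close>.
  Applied to \<open>e\<close> and \<open>- e\<close>, this gives all three roots from one.\<close>

lemma cubic_g_root_add:
  fixes u e c :: "'a::field"
  assumes "(3 :: 'a) = 0" "poly (cubic_g c (e ^ 2)) u = 0"
  shows "poly (cubic_g c (e ^ 2)) (u + e) = 0"
proof -
  have "poly (cubic_g c (e ^ 2)) (u + e) = poly (cubic_g c (e ^ 2)) u + 3 * (u * e * (u + e))"
    unfolding poly_cubic_g by algebra
  then show ?thesis using assms by simp
qed

text \<open>When \<open>d = e^2\<close>, the product of the three roots is a nonzero square if
  \<open>c\<close> is nonzero, so over a finite field the roots cannot all be non-squares.\<close>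

lemma cubic_g_roots_product:
  fixes u e c :: "'a::field"
  assumes "poly (cubic_g c (e ^ 2)) u = 0"
  shows "u * (u + e) * (u - e) = c ^ 2"
  using assms unfolding poly_cubic_g by algebra

lemma cubic_g_root_square_ne_0:
  fixes c d r :: "'a::field"
  assumes "c \<noteq> 0" "poly (cubic_g c d) (r ^ 2) = 0"
  shows "r \<noteq> 0"
  using assms by (auto simp: poly_cubic_g)

section \<open>Factorization of the quartic into quadratics\<close>

lemma monic_quadratic_mult:
  fixes a b k l :: "'a::comm_ring_1"
  shows "[:a, b, 1:] * [:k, l, 1:] = [:a * k, a * l + b * k, a + b * l + k, b + l, 1:]"
  by (simp add: algebra_simps)

text \<open>Dividing \<open>g(r^2) = 0\<close> by \<open>r^2\<close> leaves
  \<open>d = r^4 - e^2\<close>. As \<open>-2 = 1\<close>, completing the square turns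
  \<open>x^2 + r x + D_2\<close> into \<open>(x - r)^2 - D_1\<close>, so the constants of the two
  factors trade places in the third claim.\<close>

lemma quartic_h_factorization:
  fixes c d r :: "'a::field"
  assumes "(3 :: 'a) = 0" "c \<noteq> 0" "poly (cubic_g c d) (r ^ 2) = 0"
  defines "e \<equiv> c * inverse r"
  shows "d = (- (r ^ 2) + e) * (- (r ^ 2) - e)"
    and "quartic_h c d = [:- (r ^ 2) + e, r, 1:] * [:- (r ^ 2) - e, - r, 1:]"
    and "poly (quartic_h c d) x = ((x - r) ^ 2 - (- (r ^ 2) - e)) * ((x + r) ^ 2 - (- (r ^ 2) + e))"
proof -
  have r: "r \<noteq> 0" using assms cubic_g_root_square_ne_0 by blast
  have c: "c = r * e" using r by (simp add: e_def)
  have "r ^ 2 * (r ^ 4 - d - e ^ 2) = 0"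
    using assms(3) unfolding poly_cubic_g c by algebra
  then have "r ^ 4 - d - e ^ 2 = 0" using r by (simp only: mult_eq_0_iff power_eq_0_iff) simp
  then show d: "d = (- (r ^ 2) + e) * (- (r ^ 2) - e)" by algebra
  have "3 * r ^ 2 = 0" "3 * (r * e) = 0" using assms(1) by simp_all
  then have "(- (r ^ 2) + e) * - r + r * (- (r ^ 2) - e) = c"
    "(- (r ^ 2) + e) + r * - r + (- (r ^ 2) - e) = 0"
    unfolding c by algebra+
  then show fac: "quartic_h c d = [:- (r ^ 2) + e, r, 1:] * [:- (r ^ 2) - e, - r, 1:]"
    by (simp only: monic_quadratic_mult quartic_h_def flip: d) simp
  have factors: "poly [:- (r ^ 2) + e, r, 1:] x = (x - r) ^ 2 - (- (r ^ 2) - e) + 3 * (r * x - r ^ 2)"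
    "poly [:- (r ^ 2) - e, - r, 1:] x = (x + r) ^ 2 - (- (r ^ 2) + e) - 3 * (r * x + r ^ 2)"
    by (simp_all add: algebra_simps power2_eq_square)
  show "poly (quartic_h c d) x = ((x - r) ^ 2 - (- (r ^ 2) - e)) * ((x + r) ^ 2 - (- (r ^ 2) + e))"
    by (simp only: fac poly_mult factors assms(1) mult_zero_left diff_zero add_0_right)
qed

lemma quartic_h_root_iff:
  fixes c d r :: "'a::field"
  assumes "(3 :: 'a) = 0" "c \<noteq> 0" "poly (cubic_g c d) (r ^ 2) = 0"
  shows "poly (quartic_h c d) x = 0 \<longleftrightarrow>
    (x - r) ^ 2 = - (r ^ 2) - c * inverse r \<or> (x + r) ^ 2 = - (r ^ 2) + c * inverse r"
  unfolding quartic_h_factorization(3)[OF assms] by (simp only: mult_eq_0_iff right_minus_eq)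

lemma cubic_g_root_if_quadratic_factors:
  fixes c d :: "'a::field"
  assumes "(3 :: 'a) = 0" "quartic_h c d = p * q" "degree p = 2" "degree q = 2"
  shows "\<exists>r. poly (cubic_g c d) (r ^ 2) = 0"
proof -
  have quadratic: "\<exists>k l m. s = [:k, l, m:]" if "degree s = 2" for s :: "'a poly"
    by (rule exI[of _ "coeff s 0"], rule exI[of _ "coeff s 1"], rule exI[of _ "coeff s 2"], rule poly_eqI)
      (use that in \<open>auto simp: coeff_pCons coeff_eq_0 numeral_2_eq_2 split: nat.splits\<close>)
  obtain a0 a1 a2 b0 b1 b2 where p: "p = [:a0, a1, a2:]" and q: "q = [:b0, b1, b2:]"
    using quadratic assms(3,4) by metis
  have eqs: "a0 * b0 = d" "a0 * b1 + a1 * b0 = c" "a0 * b2 + a1 * b1 + a2 * b0 = 0"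
    "a1 * b2 + a2 * b1 = 0" "a2 * b2 = 1"
    using assms(2) unfolding p q quartic_h_def by (simp_all add: algebra_simps)
  \<comment> \<open>Rescaled to be monic, the factors are \<open>x^2 + r x + s\<close> and
    \<open>x^2 - r x + t\<close>, because \<open>a2 * b2 = 1\<close> and the coefficient of
    \<open>x^3\<close> vanishes.\<close>
  define r s t where "r = a1 * b2" and "s = a0 * b2" and "t = b0 * a2"
  have a1: "a1 = r * a2" using eqs(5) unfolding r_def by algebra
  have b1: "b1 = - (r * b2)" using eqs(4,5) unfolding r_def by algebra
  have "s * t = (a0 * b0) * (a2 * b2)" by (simp add: s_def t_def mult_ac)
  then have d: "d = s * t" using eqs(1,5) by simp
  have c: "c = r * (t - s)" using eqs(2) unfolding s_def t_def a1 b1 by (simp add: algebra_simps)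
  have r: "r ^ 2 = s + t" using eqs(3,5) unfolding s_def t_def a1 b1 by algebra
  have "c ^ 2 = (s + t) * (t - s) ^ 2" by (simp add: c r power_mult_distrib)
  then have "poly (cubic_g c d) (r ^ 2) = (s + t) ^ 3 - s * t * (s + t) - (s + t) * (t - s) ^ 2"
    by (simp only: poly_cubic_g d r)
  also have "\<dots> = 3 * (s * t * (s + t))" by algebra
  finally show ?thesis using assms(1) by auto
qed

text \<open>Modulo 3, \<open>u (u - a^2)^2 = (a u + c)^2\<close>; dividing requires \<open>u\<close>
  to differ from \<open>a^2\<close>, which is itself a square.\<close>

lemma is_square_cubic_g_root_if_quartic_h_root:
  fixes a c d u :: "'a::field"
  assumes "(3 :: 'a) = 0" "poly (quartic_h c d) a = 0" "poly (cubic_g c d) u = 0"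
  shows "is_square u"
proof (cases "u = a ^ 2")
  case False
  have "u * (u - a ^ 2) ^ 2 = (a * u + c) ^ 2 - 3 * (a * u * (c + a * u))"
    using assms(2,3) unfolding poly_quartic_h poly_cubic_g by algebra
  then have "u = ((a * u + c) / (u - a ^ 2)) ^ 2"
    using False assms(1) by (simp add: power_divide eq_divide_eq)
  then show ?thesis by (rule is_nth_powerI)
qed simp

section \<open>Irreducibility and roots\<close>

lemma poly_root_if_degree_1:
  fixes p :: "'a::field poly"
  assumes "degree p = 1"
  shows "\<exists>x. poly p x = 0"
proof -
  have "p = [:coeff p 0, coeff p 1:]"
    using assms by (intro poly_eqI) (auto simp: coeff_pCons coeff_eq_0 split: nat.splits)
  moreover have "coeff p 1 \<noteq> 0" using assms by (metis leading_coeff_0_iff degree_0 zero_neq_one)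
  ultimately obtain a b where "p = [:a, b:]" "b \<noteq> 0" by blast
  then have "poly p (- a / b) = 0" by simp
  then show ?thesis by blast
qed

lemma irreducible_if_no_root:
  fixes p :: "'a::field poly"
  assumes "degree p \<in> {2, 3}" "\<And>x. poly p x \<noteq> 0"
  shows "irreducible p"
proof (rule irreducibleI)
  show "p \<noteq> 0" "\<not> p dvd 1" using assms(1) by (auto simp: is_unit_poly_iff)
next
  fix a b assume ab: "p = a * b"
  then have "a \<noteq> 0" "b \<noteq> 0" using assms(1) by auto
  moreover from this have "degree a + degree b \<in> {2, 3}" using assms(1) ab by (simp add: degree_mult_eq)
  moreover have "degree a \<noteq> 1" "degree b \<noteq> 1"
    using poly_root_if_degree_1 assms(2) unfolding ab poly_mult by fastforce+
  ultimately show "a dvd 1 \<or> b dvd 1" by (auto simp: is_unit_iff_degree)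
qed

lemma no_root_if_irreducible:
  fixes p :: "'a::field poly"
  assumes "irreducible p" "degree p > 1"
  shows "poly p x \<noteq> 0"
proof
  assume "poly p x = 0"
  then obtain q where q: "p = [:- x, 1:] * q" by (auto simp: poly_eq_0_iff_dvd)
  have p0: "p \<noteq> 0" using assms(2) by auto
  then have "q \<noteq> 0" using q by auto
  then have "degree p = 1 + degree q" unfolding q by (subst degree_mult_eq) auto
  moreover have "[:- x, 1:] dvd 1 \<or> q dvd 1" using irreducibleD[OF assms(1) q] .
  ultimately show False using assms(2) \<open>q \<noteq> 0\<close> by (auto simp: is_unit_iff_degree)
qed

text \<open>A proper factorization has a linear factor, hence a root, or two quadratic factors,
  hence a square root of the resolvent equation.\<close>

lemma irreducible_quartic_h:
  fixes c d :: "'a::field"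
  assumes "(3 :: 'a) = 0" "\<And>x. poly (quartic_h c d) x \<noteq> 0" "\<And>r. poly (cubic_g c d) (r ^ 2) \<noteq> 0"
  shows "irreducible (quartic_h c d)"
proof (rule irreducibleI)
  show "quartic_h c d \<noteq> 0" "\<not> quartic_h c d dvd 1" by (auto simp: is_unit_iff_degree quartic_h_def)
next
  fix a b assume ab: "quartic_h c d = a * b"
  then have nz: "a \<noteq> 0" "b \<noteq> 0" by (auto simp: quartic_h_def)
  then have sum: "degree a + degree b = 4" using ab degree_quartic_h by (metis degree_mult_eq)
  have "degree a \<noteq> 1" "degree b \<noteq> 1"
    using poly_root_if_degree_1 assms(2) unfolding ab poly_mult by fastforce+
  moreover have "degree a \<noteq> 2 \<or> degree b \<noteq> 2"
    using cubic_g_root_if_quadratic_factors[OF assms(1) ab] assms(3) by blast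
  ultimately have "degree a = 0 \<or> degree b = 0" using sum by presburger
  then show "a dvd 1 \<or> b dvd 1" using nz by (simp add: is_unit_iff_degree)
qed

section \<open>A root of the quartic when the cubic has none\<close>

text \<open>
  If $g$ has no root, then $x^3 - dx$ is not injective, so $d = e^2$ with $e \ne 0$, and with
  $c = e^2 b$ the absence of roots says that $eb^2$ is not of the form $w^3 - w$. That $1/b'$ is
  a root of $h$ means $b = f(b')$ where $f(b') = -(b' + e^{-2}b'^{-3})$. The set $S$ of all $b$
  for which $eb^2$ is not of that form is mapped into itself by $f$, and injectively, as two roots of $h$ would yield a root of $g$.
  Since $S$ is finite, $f$ is onto $S$.
\<close>
lemma ex1_root_quartic_h_if_no_root_cubic_g:
  fixes c d :: "'a::{field, finite}"
  assumes three: "(3 :: 'a) = 0" and no_root: "\<And>u. poly (cubic_g c d) u \<noteq> 0"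
  shows "\<exists>!x. poly (quartic_h c d) x = 0"
proof -
  have "\<not> surj (\<lambda>x. x ^ 3 - d * x)"
  proof
    assume "surj (\<lambda>x. x ^ 3 - d * x)"
    then obtain u where "c ^ 2 = u ^ 3 - d * u" by (rule surjE)
    with no_root[of u] show False by (simp add: poly_cubic_g)
  qed
  then have "\<not> inj (\<lambda>x. x ^ 3 - d * x)" by (meson finite finite_UNIV_inj_surj)
  then obtain x y where xy: "x \<noteq> y" "x ^ 3 - d * x = y ^ 3 - d * y" by (auto simp: inj_def)
  define e where "e = x - y"
  have e: "e \<noteq> 0" using xy by (simp add: e_def)
  have "e * (e ^ 2 - d) = - 3 * (x * y * (x - y))"
    using xy(2) unfolding e_def by algebra
  then have "e ^ 2 - d = 0" using e three by simp
  then have d: "d = e ^ 2" by algebra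
  define S where "S = {b. \<forall>w. w ^ 3 - w \<noteq> e * b ^ 2}"
  define f where "f b = - (b + 1 / (e ^ 2 * b ^ 3))" for b
  have S_ne_0: "b \<noteq> 0" if "b \<in> S" for b
    using that by (auto simp: S_def dest: spec[of _ 0])
  \<comment> \<open>The substitution \<open>u = e w\<close> scales the cubic with constant term
    \<open>- (e^2 b)^2\<close> to \<open>w^3 - w - e b^2\<close>.\<close>
  have S_iff: "b \<in> S \<longleftrightarrow> (\<forall>u. poly (cubic_g (e ^ 2 * b) (e ^ 2)) u \<noteq> 0)" for b
  proof -
    have "poly (cubic_g (e ^ 2 * b) (e ^ 2)) (e * w) = e ^ 3 * (w ^ 3 - w - e * b ^ 2)" for w
      unfolding poly_cubic_g by algebra
    then have *: "poly (cubic_g (e ^ 2 * b) (e ^ 2)) (e * w) = 0 \<longleftrightarrow> w ^ 3 - w = e * b ^ 2" for w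
      using e by (simp only: mult_eq_0_iff power_eq_0_iff right_minus_eq) simp
    show ?thesis
    proof
      assume b: "b \<in> S"
      show "\<forall>u. poly (cubic_g (e ^ 2 * b) (e ^ 2)) u \<noteq> 0"
      proof
        fix u
        have "e * (u / e) = u" using e by simp
        then show "poly (cubic_g (e ^ 2 * b) (e ^ 2)) u \<noteq> 0"
          using b *[of "u / e"] by (simp add: S_def)
      qed
    qed (use * in \<open>auto simp: S_def\<close>)
  qed
  have root: "poly (quartic_h (e ^ 2 * f b) (e ^ 2)) (1 / b) = 0" if "b \<in> S" for b
  proof -
    define i where "i = 1 / b"
    have i: "b * i = 1" using S_ne_0[OF that] by (simp add: i_def)
    have "e ^ 2 * f b = - (e ^ 2 * b + i ^ 3)"
      using S_ne_0[OF that] e by (simp add: f_def i_def field_simps)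
    then have "poly (quartic_h (e ^ 2 * f b) (e ^ 2)) i = i ^ 4 - (e ^ 2 * b + i ^ 3) * i + e ^ 2"
      by (simp only: poly_quartic_h mult_minus_left add_uminus_conv_diff)
    also have "\<dots> = 0" using i by algebra
    finally show ?thesis unfolding i_def .
  qed
  have "f b \<in> S" if "b \<in> S" for b
  proof (rule ccontr)
    assume "f b \<notin> S"
    then obtain w where w: "w ^ 3 - w = e * f b ^ 2" unfolding S_def by blast
    \<comment> \<open>With this \<open>z\<close>, \<open>e (f b)^2\<close> exceeds
      \<open>e b^2\<close> by \<open>z^3 + 2 z\<close>, which is \<open>z^3 - z\<close> in
      characteristic 3. Hence \<open>w - z\<close> solves the equation for \<open>b\<close> whenever
      \<open>w\<close> solves it for \<open>f b\<close>.\<close>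
    define z where "z = 1 / (e * b ^ 2)"
    have "e * b ^ 2 * z = 1" and "f b = - (b * (1 + z ^ 2))"
      using S_ne_0[OF that] e unfolding f_def z_def
      by (simp_all add: field_simps power2_eq_square power3_eq_cube)
    then have "e * f b ^ 2 = e * b ^ 2 + 2 * z + z ^ 3" by algebra
    moreover have "(w - z) ^ 3 - (w - z) = (w ^ 3 - w) - z ^ 3 - 2 * z + 3 * (z - w * z * (w - z))"
      by algebra
    ultimately have "(w - z) ^ 3 - (w - z) = e * b ^ 2" using three w by simp
    then show False using that unfolding S_def by blast
  qed
  then have "f ` S \<subseteq> S" by blast
  moreover have "inj_on f S"
  proof (rule inj_onI, rule ccontr)
    fix a b assume ab: "a \<in> S" "b \<in> S" "f a = f b" "a \<noteq> b"
    then have "1 / a \<noteq> 1 / b" by simp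
    from cubic_g_root_if_two_roots_quartic_h[OF three this root[OF ab(1), unfolded ab(3)] root[OF ab(2)]]
    have "poly (cubic_g (e ^ 2 * f b) (e ^ 2)) ((1 / a + 1 / b) ^ 2) = 0" .
    then have "f b \<notin> S" unfolding S_iff by blast
    with \<open>f ` S \<subseteq> S\<close> ab show False by blast
  qed
  ultimately have "f ` S = S" by (intro endo_inj_surj) auto
  moreover have "c / e ^ 2 \<in> S" using no_root e unfolding S_iff d by simp
  ultimately obtain b where b: "b \<in> S" "c / e ^ 2 = f b" by blast
  then have "c = e ^ 2 * f b" using e by (simp add: field_simps)
  then have "poly (quartic_h c d) (1 / b) = 0" using root[OF b(1)] d by simp
  moreover have "x = y" if "poly (quartic_h c d) x = 0" "poly (quartic_h c d) y = 0" for x y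
    using cubic_g_root_if_two_roots_quartic_h[OF three _ that] no_root by blast
  ultimately show ?thesis by blast
qed

section \<open>Square roots of the cubic and the discriminants\<close>

text \<open>By Vieta the third root of the cubic is \<open>k^2\<close> with
  \<open>k = c / (r s)\<close>, and the roots sum to zero. So \<open>D_1 = s^2 + k^2 - s k\<close>,
  which is \<open>(s + k)^2\<close> modulo 3.\<close>

lemma is_square_discriminant_if_square_cubic_g_roots:
  fixes c d r s :: "'a::field"
  assumes "(3 :: 'a) = 0" "c \<noteq> 0" "r ^ 2 \<noteq> s ^ 2"
    and "poly (cubic_g c d) (r ^ 2) = 0" "poly (cubic_g c d) (s ^ 2) = 0"
  shows "is_square (- (r ^ 2) - c * inverse r)"
proof -
  have nz: "r \<noteq> 0" "s \<noteq> 0" using assms cubic_g_root_square_ne_0 by blast+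
  define k where "k = c / (r * s)"
  have c: "c = r * s * k" using nz by (simp add: k_def)
  have "(r ^ 2 - s ^ 2) * (r ^ 2 * s ^ 2 * (k ^ 2 + r ^ 2 + s ^ 2)) = 0"
    using assms(4,5) unfolding poly_cubic_g c by algebra
  then have k: "k ^ 2 + r ^ 2 + s ^ 2 = 0" using assms(3) nz by simp
  have "- (r ^ 2) - c * inverse r = - (r ^ 2) - s * k" using nz by (simp add: c)
  also have "\<dots> = (s + k) ^ 2 - 3 * (s * k)" using k by algebra
  finally show ?thesis using assms(1) by (auto intro: is_nth_powerI)
qed

lemma quartic_h_root_if_is_square_discriminant:
  fixes c d r :: "'a::field"
  assumes "(3 :: 'a) = 0" "c \<noteq> 0" "poly (cubic_g c d) (r ^ 2) = 0"
    and "is_square (- (r ^ 2) - c * inverse r) \<or> is_square (- (r ^ 2) + c * inverse r)"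
  shows "\<exists>x. poly (quartic_h c d) x = 0"
  using assms(4)
proof
  assume "is_square (- (r ^ 2) - c * inverse r)"
  then obtain y where "- (r ^ 2) - c * inverse r = y ^ 2" by (rule is_nth_powerE)
  then have "poly (quartic_h c d) (r + y) = 0" unfolding quartic_h_root_iff[OF assms(1-3)] by simp
  then show ?thesis by blast
next
  assume "is_square (- (r ^ 2) + c * inverse r)"
  then obtain y where "- (r ^ 2) + c * inverse r = y ^ 2" by (rule is_nth_powerE)
  then have "poly (quartic_h c d) (y - r) = 0" unfolding quartic_h_root_iff[OF assms(1-3)] by simp
  then show ?thesis by blast
qed

section \<open>Complete splitting\<close>

lemma cubic_g_root_unique_if_d_0:
  fixes c u v :: "'a::field"
  assumes "(3 :: 'a) = 0" "poly (cubic_g c 0) u = 0" "poly (cubic_g c 0) v = 0"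
  shows "u = v"
proof -
  have "(u - v) ^ 3 = - 3 * (u * v * (u - v))"
    using assms(2,3) unfolding poly_cubic_g by algebra
  then show ?thesis using assms(1) by simp
qed

lemma linear_factors_mult:
  fixes k l s t :: "'a::comm_ring_1"
  assumes "k = s * t" "l = - s - t"
  shows "[:k, l, 1:] = [:- s, 1:] * [:- t, 1:]"
  using assms by simp

text \<open>For roots \<open>a\<close>, \<open>b\<close>, \<open>x\<close>, \<open>y\<close> the
  witnesses are \<open>a + b\<close>, \<open>a + x\<close>, \<open>a + y\<close>. As
  \<open>x + y = - (a + b)\<close>, the two discriminants for \<open>a + b\<close> are
  \<open>(a - b)^2\<close> and \<open>(x - y)^2\<close>. Conversely, square discriminants split both
  quadratic factors.\<close>

lemma splits_quartic_h_iff: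
  fixes c d :: "'a::{field, finite}"
  assumes card: "CARD('a) = 3 ^ m" and c: "c \<noteq> 0"
  shows "splits_into_distinct_linear_factors (quartic_h c d) \<longleftrightarrow>
    (\<exists>r1 r2 r3. distinct [r1, r2, r3] \<and>
      (\<forall>r \<in> {r1, r2, r3}. poly (cubic_g c d) (r ^ 2) = 0 \<and>
        is_square (- (r ^ 2) + c * inverse r) \<and> is_square (- (r ^ 2) - c * inverse r)))"
    (is "?L \<longleftrightarrow> (\<exists>r1 r2 r3. _ \<and> (\<forall>r \<in> _. ?P r))")
proof
  note three = three_eq_0_if_CARD[OF card]
  assume ?L
  moreover have "lead_coeff (quartic_h c d) = 1" by (simp add: quartic_h_def)
  ultimately obtain A where A: "finite A" "quartic_h c d = (\<Prod>a\<in>A. [:- a, 1:])"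
    unfolding splits_into_distinct_linear_factors_def by auto
  have "card A = degree (quartic_h c d)"
    unfolding A(2) by (subst degree_prod_eq_sum_degree) auto
  then have "card A = 4" by (simp add: degree_quartic_h)
  moreover obtain as where as: "set as = A" "distinct as" using finite_distinct_list[OF A(1)] by blast
  ultimately have "length as = 4" using distinct_card by metis
  then obtain a b x y where abxy: "as = [a, b, x, y]"
    by (auto simp: numeral_eq_Suc length_Suc_conv)
  have roots: "poly (quartic_h c d) z = 0" if "z \<in> A" for z
    using A that by (auto simp: poly_prod)
  have *: "?P (a + b)" if dist: "distinct [a, b, x, y]" and subset: "{a, b, x, y} \<subseteq> A" for a b x y
  proof -
    have "a + b + x + y = 0"
      by (rule sum_roots_quartic_h[OF three dist, of c d]) (use subset roots in blast)
    then have xy: "x + y = - (a + b)" by algebra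
    have "- ((x + y) ^ 2) + c * inverse (x + y) = (x - y) ^ 2"
      by (rule discriminant_if_two_roots_quartic_h[of _ _ c d]) (use three c dist subset roots in auto)
    then have "- ((a + b) ^ 2) - c * inverse (a + b) = (x - y) ^ 2"
      unfolding xy power2_minus inverse_minus_eq by simp
    moreover have "- ((a + b) ^ 2) + c * inverse (a + b) = (a - b) ^ 2"
      by (rule discriminant_if_two_roots_quartic_h[of _ _ c d]) (use three c dist subset roots in auto)
    moreover have "poly (cubic_g c d) ((a + b) ^ 2) = 0"
      by (rule cubic_g_root_if_two_roots_quartic_h) (use three dist subset roots in auto)
    ultimately show ?thesis by simp
  qed
  have "?P (a + b)" "?P (a + x)" "?P (a + y)"
    by (rule *[of a b x y] *[of a x b y] *[of a y b x]; use as abxy in auto)+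
  moreover have "distinct [a + b, a + x, a + y]" using as(2) abxy by auto
  ultimately show "\<exists>r1 r2 r3. distinct [r1, r2, r3] \<and> (\<forall>r \<in> {r1, r2, r3}. ?P r)"
    by (intro exI[of _ "a + b"] exI[of _ "a + x"] exI[of _ "a + y"]) blast
next
  note three = three_eq_0_if_CARD[OF card]
  assume "\<exists>r1 r2 r3. distinct [r1, r2, r3] \<and> (\<forall>r \<in> {r1, r2, r3}. ?P r)"
  then obtain r s t where dist: "distinct [r, s, t]" and P: "?P r" "?P s" "?P t" by blast
  \<comment> \<open>If \<open>d = 0\<close>, all three squares coincide, and at most two elements
    share a square.\<close>
  have "d \<noteq> 0"
  proof
    assume "d = 0"
    then have "r ^ 2 = s ^ 2" "r ^ 2 = t ^ 2" using cubic_g_root_unique_if_d_0[OF three, of c] P by blast+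
    with dist show False by (auto simp: power2_eq_iff)
  qed
  define e where "e = c * inverse r"
  obtain p q where p: "- (r ^ 2) - e = p ^ 2" and q: "- (r ^ 2) + e = q ^ 2"
    using P(1) unfolding e_def by (auto elim!: is_nth_powerE)
  \<comment> \<open>The completed squares have roots \<open>r + p\<close>, \<open>r - p\<close> and
    \<open>- r + q\<close>, \<open>- r - q\<close>; the multiples of 3 are dropped
    afterwards.\<close>
  have "- (r ^ 2) + e = (r + p) * (r - p) - 3 * r ^ 2"
    "- (r ^ 2) - e = (- r + q) * (- r - q) - 3 * r ^ 2"
    "r = - (r + p) - (r - p) + 3 * r" "- r = - (- r + q) - (- r - q) - 3 * r"
    using p q by algebra+
  then have "- (r ^ 2) + e = (r + p) * (r - p)" "- (r ^ 2) - e = (- r + q) * (- r - q)"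
    "r = - (r + p) - (r - p)" "- r = - (- r + q) - (- r - q)"
    unfolding three by (simp_all only: mult_zero_left diff_zero add_0_right)
  then have "[:- (r ^ 2) + e, r, 1:] = [:- (r + p), 1:] * [:- (r - p), 1:]"
    "[:- (r ^ 2) - e, - r, 1:] = [:- (- r + q), 1:] * [:- (- r - q), 1:]"
    by - (rule linear_factors_mult; assumption)+
  then have "quartic_h c d = (\<Prod>a\<leftarrow>[r + p, r - p, - r + q, - r - q]. [:- a, 1:])"
    using quartic_h_factorization(2)[OF three c conjunct1[OF P(1)]]
    by (simp only: e_def[symmetric] list.map prod_list.Cons prod_list.Nil mult_1_right mult.assoc)
  moreover have "lead_coeff (quartic_h c d) = 1" by (simp add: quartic_h_def)
  ultimately have "\<exists>as. quartic_h c d = smult (lead_coeff (quartic_h c d)) (\<Prod>a\<leftarrow>as. [:- a, 1:])"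
    by (metis smult_1_left)
  with splits_into_distinct_linear_factors_iff_if_rsquarefree[OF rsquarefree_quartic_h[OF card \<open>d \<noteq> 0\<close>]]
  show ?L by blast
qed

section \<open>Two irreducible quadratic factors\<close>

lemma cubic_g_roots_if_is_square:
  fixes c e u :: "'a::field"
  assumes "(3 :: 'a) = 0" "e \<noteq> 0" "poly (cubic_g c (e ^ 2)) u = 0"
  shows "distinct [u + e, u - e, u]"
    and "poly (cubic_g c (e ^ 2)) (u + e) = 0" and "poly (cubic_g c (e ^ 2)) (u - e) = 0"
proof -
  have "2 * e \<noteq> 0" using assms(2) two_ne_0_if_three_eq_0[OF assms(1)] by simp
  then have "u + e \<noteq> u - e" by (simp add: algebra_simps flip: mult_2)
  then show "distinct [u + e, u - e, u]" using assms(2) by simp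
  show "poly (cubic_g c (e ^ 2)) (u + e) = 0" "poly (cubic_g c (e ^ 2)) (u - e) = 0"
    using cubic_g_root_add[OF assms(1,3)] cubic_g_root_add[of c "- e" u] assms(1,3) by simp_all
qed

text \<open>Without roots of the quartic both discriminants are non-squares, so their product
  \<open>d = e^2\<close> is a square and the cubic has the roots \<open>r^2\<close>,
  \<open>r^2 + e\<close>, \<open>r^2 - e\<close>. A second square among them would make a
  discriminant a square. Conversely, non-square discriminants leave both quadratic factors without
  roots.\<close>

lemma quartic_h_irreducible_quadratics_iff:
  fixes c d :: "'a::{field, finite}"
  assumes three: "(3 :: 'a) = 0" and c: "c \<noteq> 0"
  shows "(\<exists>p1 p2. irreducible p1 \<and> irreducible p2 \<and> degree p1 = 2 \<and> degree p2 = 2 \<and>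
      quartic_h c d = p1 * p2) \<longleftrightarrow>
    (\<exists>u1 u2 u3. distinct [u1, u2, u3] \<and>
      poly (cubic_g c d) u1 = 0 \<and> poly (cubic_g c d) u2 = 0 \<and> poly (cubic_g c d) u3 = 0 \<and>
      \<not> is_square u1 \<and> \<not> is_square u2 \<and>
      (\<exists>r. u3 = r ^ 2 \<and>
        \<not> is_square (- (r ^ 2) + c * inverse r) \<and> \<not> is_square (- (r ^ 2) - c * inverse r)))"
    (is "?L \<longleftrightarrow> ?R")
proof
  assume ?L
  then obtain p q where pq: "irreducible p" "irreducible q" "degree p = 2" "degree q = 2"
    "quartic_h c d = p * q" by blast
  have no_root: "poly (quartic_h c d) x \<noteq> 0" for x
    using no_root_if_irreducible[OF pq(1)] no_root_if_irreducible[OF pq(2)] pq(3-5) by simp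
  obtain r where r: "poly (cubic_g c d) (r ^ 2) = 0"
    using cubic_g_root_if_quadratic_factors[OF three pq(5,3,4)] by blast
  have disc: "\<not> is_square (- (r ^ 2) + c * inverse r)" "\<not> is_square (- (r ^ 2) - c * inverse r)"
    using quartic_h_root_if_is_square_discriminant[OF three c r] no_root by blast+
  then have "is_square d"
    unfolding quartic_h_factorization(1)[OF three c r] by (rule is_square_mult_if_nonsquares)
  then obtain e where d: "d = e ^ 2" by (rule is_nth_powerE)
  have e: "e \<noteq> 0" using no_root[of 0] by (auto simp: poly_quartic_h d)
  note roots = cubic_g_roots_if_is_square[OF three e r[unfolded d]]
  have nonsquare: "\<not> is_square u" if u: "poly (cubic_g c d) u = 0" "u \<noteq> r ^ 2" for u
  proof
    assume "is_square u"
    then obtain s where s: "u = s ^ 2" by (rule is_nth_powerE)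
    show False
      using is_square_discriminant_if_square_cubic_g_roots[OF three c _ r u(1)[unfolded s]] u(2) disc
      by (simp add: s)
  qed
  then have "\<not> is_square (r ^ 2 + e)" "\<not> is_square (r ^ 2 - e)" using roots e by (auto simp: d)
  with roots disc r show ?R unfolding d by blast
next
  assume ?R
  then obtain r where r: "poly (cubic_g c d) (r ^ 2) = 0"
    and disc: "\<not> is_square (- (r ^ 2) + c * inverse r)" "\<not> is_square (- (r ^ 2) - c * inverse r)"
    by blast
  define p q where "p = [:- (r ^ 2) + c * inverse r, r, 1:]" and "q = [:- (r ^ 2) - c * inverse r, - r, 1:]"
  have pq: "quartic_h c d = p * q" unfolding p_def q_def by (rule quartic_h_factorization(2)[OF three c r])
  have "poly (quartic_h c d) x \<noteq> 0" for x
    using disc unfolding quartic_h_root_iff[OF three c r] by (metis is_nth_powerI)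
  then have "poly p x \<noteq> 0" "poly q x \<noteq> 0" for x unfolding pq by auto
  moreover have deg: "degree p = 2" "degree q = 2" by (simp_all add: p_def q_def)
  ultimately have "irreducible p" "irreducible q" by (auto intro!: irreducible_if_no_root)
  with pq deg show ?L by blast
qed

section \<open>A unique root of the quartic\<close>

lemma ex1_root_quartic_h_iff:
  fixes c d :: "'a::{field, finite}"
  assumes three: "(3 :: 'a) = 0" and c: "c \<noteq> 0"
  shows "(\<exists>!x. poly (quartic_h c d) x = 0) \<longleftrightarrow> irreducible (cubic_g c d)"
proof
  assume ex1: "\<exists>!x. poly (quartic_h c d) x = 0"
  then obtain a where a: "poly (quartic_h c d) a = 0" by blast
  show "irreducible (cubic_g c d)"
  proof (rule irreducible_if_no_root)
    fix u show "poly (cubic_g c d) u \<noteq> 0"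
    proof
      assume u: "poly (cubic_g c d) u = 0"
      obtain s where s: "u = s ^ 2"
        using is_square_cubic_g_root_if_quartic_h_root[OF three a u] by (rule is_nth_powerE)
      have "(a - s) ^ 2 = - (s ^ 2) - c * inverse s \<or> (a + s) ^ 2 = - (s ^ 2) + c * inverse s"
        using a quartic_h_root_iff[OF three c u[unfolded s]] by blast
      \<comment> \<open>Choosing \<open>r\<close> as \<open>s\<close> or \<open>- s\<close> puts
        \<open>a\<close> on the factor \<open>(x - r)^2 - D_1\<close>.\<close>
      then obtain r where r: "poly (cubic_g c d) (r ^ 2) = 0"
        and ar: "(a - r) ^ 2 = - (r ^ 2) - c * inverse r"
        using that[of s] that[of "- s"] u s by auto
      have iff: "poly (quartic_h c d) x = 0 \<longleftrightarrow>
          (x - r) ^ 2 = - (r ^ 2) - c * inverse r \<or> (x + r) ^ 2 = - (r ^ 2) + c * inverse r" for x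
        by (rule quartic_h_root_iff[OF three c r])
      \<comment> \<open>Reflecting \<open>a\<close> in \<open>r\<close> gives another root of the
        same factor, so uniqueness forces \<open>a = r\<close>.\<close>
      have "(r - (a - r) - r) ^ 2 = (a - r) ^ 2" by algebra
      then have "poly (quartic_h c d) (r - (a - r)) = 0" using ar iff by metis
      then have "a = r - (a - r)" using ex1 a by blast
      then have "2 * (a - r) = 0" by algebra
      then have "a = r" using two_ne_0_if_three_eq_0[OF three] by simp
      \<comment> \<open>\<open>a = r\<close> makes \<open>D_1\<close> vanish, hence
        \<open>d = D_1 D_2 = 0\<close>.\<close>
      moreover have "poly (quartic_h c d) 0 = 0"
        using ar \<open>a = r\<close> quartic_h_factorization(1)[OF three c r] by (simp add: poly_quartic_h)
      ultimately have "r = 0" using ex1 a by blast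
      then show False using cubic_g_root_square_ne_0[OF c r] by blast
    qed
  qed (simp add: degree_cubic_g)
next
  assume "irreducible (cubic_g c d)"
  then have "poly (cubic_g c d) u \<noteq> 0" for u
    by (rule no_root_if_irreducible) (simp add: degree_cubic_g)
  then show "\<exists>!x. poly (quartic_h c d) x = 0"
    by (rule ex1_root_quartic_h_if_no_root_cubic_g[OF three])
qed

section \<open>Irreducibility of the quartic\<close>

text \<open>A square root of the cubic would factor the quartic, and a cubic without roots would
  give the quartic a root. With two roots \<open>u\<close>, \<open>v\<close> the third is
  \<open>c^2 / (u v)\<close>, a square because \<open>u\<close> and \<open>v\<close> are
  non-squares.\<close>

lemma irreducible_quartic_h_iff:
  fixes c d :: "'a::{field, finite}"
  assumes three: "(3 :: 'a) = 0" and c: "c \<noteq> 0"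
  shows "irreducible (quartic_h c d) \<longleftrightarrow>
    (\<exists>u. poly (cubic_g c d) u = 0 \<and> (\<forall>v. poly (cubic_g c d) v = 0 \<longrightarrow> v = u) \<and> \<not> is_square u)"
proof
  assume irred: "irreducible (quartic_h c d)"
  have no_root: "poly (quartic_h c d) x \<noteq> 0" for x
    using irred by (rule no_root_if_irreducible) (simp add: degree_quartic_h)
  have nonsquare: "\<not> is_square u" if "poly (cubic_g c d) u = 0" for u
  proof
    assume "is_square u"
    then obtain r where "u = r ^ 2" by (rule is_nth_powerE)
    with that have "poly (cubic_g c d) (r ^ 2) = 0" by simp
    from irreducibleD[OF irred quartic_h_factorization(2)[OF three c this]]
    show False by (auto simp: is_unit_poly_iff)
  qed
  obtain u where u: "poly (cubic_g c d) u = 0"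
    using ex1_root_quartic_h_if_no_root_cubic_g[OF three, of c d] no_root by blast
  have "v = u" if v: "poly (cubic_g c d) v = 0" for v
  proof (rule ccontr)
    assume "v \<noteq> u"
    define e where "e = v - u"
    have e: "e \<noteq> 0" and ue: "u + e = v" using \<open>v \<noteq> u\<close> by (simp_all add: e_def)
    have d: "d = e ^ 2"
      unfolding e_def by (rule square_diff_roots_cubic_g[OF three \<open>v \<noteq> u\<close> v u])
    have prod: "u * v * (u - e) = c ^ 2"
      using cubic_g_roots_product[of c e u] u unfolding d ue by simp
    have "is_square (u * v)" using u v by (intro is_square_mult_if_nonsquares nonsquare)
    then obtain t where "u * v = t ^ 2" by (rule is_nth_powerE)
    with prod have prod: "t ^ 2 * (u - e) = c ^ 2" by simp
    then have "t \<noteq> 0" using c by auto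
    then have "u - e = (c / t) ^ 2"
      unfolding power_divide by (subst eq_divide_eq) (simp add: prod[symmetric] mult.commute)
    moreover have "poly (cubic_g c d) (u - e) = 0"
      using cubic_g_roots_if_is_square(3)[OF three e] u unfolding d by blast
    ultimately show False using nonsquare by fastforce
  qed
  with u nonsquare
  show "\<exists>u. poly (cubic_g c d) u = 0 \<and> (\<forall>v. poly (cubic_g c d) v = 0 \<longrightarrow> v = u) \<and> \<not> is_square u"
    by blast
next
  assume "\<exists>u. poly (cubic_g c d) u = 0 \<and> (\<forall>v. poly (cubic_g c d) v = 0 \<longrightarrow> v = u) \<and> \<not> is_square u"
  then obtain u where u: "poly (cubic_g c d) u = 0" "\<not> is_square u"
    and unique: "\<And>v. poly (cubic_g c d) v = 0 \<Longrightarrow> v = u" by blast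
  show "irreducible (quartic_h c d)"
  proof (rule irreducible_quartic_h[OF three])
    show "poly (quartic_h c d) x \<noteq> 0" for x
      using is_square_cubic_g_root_if_quartic_h_root[OF three _ u(1)] u(2) by blast
    show "poly (cubic_g c d) (r ^ 2) \<noteq> 0" for r
      using unique[of "r ^ 2"] u(2) by auto
  qed
qed

section \<open>Exactly two roots\<close>

text \<open>Cubing is bijective, so \<open>c = a^3\<close> and the quartic is
  \<open>x (x + a)^3\<close>. This rules out \<open>d = 0\<close> when the roots number two with
  multiplicity.\<close>

lemma size_proots_quartic_h_d_0:
  fixes c :: "'a::{field, finite}"
  assumes three: "(3 :: 'a) = 0"
  shows "size (proots (quartic_h c 0)) = 4"
proof -
  have "inj (\<lambda>x :: 'a. x ^ 3)"
  proof (rule injI)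
    fix x y :: 'a assume "x ^ 3 = y ^ 3"
    then have "(x - y) ^ 3 = - 3 * (x * y * (x - y))" by algebra
    then show "x = y" using three by simp
  qed
  then have "surj (\<lambda>x :: 'a. x ^ 3)" by (meson finite finite_UNIV_inj_surj)
  then obtain a where a: "c = a ^ 3" by (rule surjE)
  have "[:a, 1:] ^ 3 = [:a ^ 3, 3 * a ^ 2, 3 * a, 1:]"
    by (simp add: power3_eq_cube power2_eq_square)
  then have "quartic_h c 0 = [:0, 1:] * [:a, 1:] ^ 3"
    by (simp add: quartic_h_def a three)
  also have "proots \<dots> = proots [:0, 1:] + repeat_mset 3 (proots [:a, 1:])"
    by (subst proots_mult) (simp_all add: proots_power del: mult_pCons_left)
  also have "size \<dots> = 4" by simp
  finally show ?thesis .
qed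

text \<open>The factor with discriminant \<open>D_1\<close> contributes two roots, distinct because
  \<open>d\<close> is nonzero, and the other factor contributes none.\<close>

lemma card_roots_quartic_h_if_discriminant:
  fixes c d r :: "'a::field"
  assumes three: "(3 :: 'a) = 0" and c: "c \<noteq> 0" and r: "poly (cubic_g c d) (r ^ 2) = 0" and d: "d \<noteq> 0"
    and sq: "is_square (- (r ^ 2) - c * inverse r)" and nsq: "\<not> is_square (- (r ^ 2) + c * inverse r)"
  shows "card {x. poly (quartic_h c d) x = 0} = 2"
proof -
  obtain y where y: "- (r ^ 2) - c * inverse r = y ^ 2" using sq by (rule is_nth_powerE)
  have "y \<noteq> 0" using d y quartic_h_factorization(1)[OF three c r] by auto
  then have "2 * y \<noteq> 0" using two_ne_0_if_three_eq_0[OF three] by simp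
  then have "r + y \<noteq> r - y" by (simp add: algebra_simps flip: mult_2)
  have "(x + r) ^ 2 \<noteq> - (r ^ 2) + c * inverse r" for x
    using nsq by (metis is_nth_powerI)
  then have "{x. poly (quartic_h c d) x = 0} = {x. (x - r) ^ 2 = y ^ 2}"
    unfolding quartic_h_root_iff[OF three c r] y by simp
  also have "\<dots> = {r + y, r - y}"
    by (auto simp: power2_eq_iff algebra_simps eq_diff_eq)
  also have "card \<dots> = 2" using \<open>r + y \<noteq> r - y\<close> by simp
  finally show ?thesis .
qed

text \<open>The expression required to be a non-square equals \<open>d = D_1 D_2\<close>. Its being
  a non-square means that exactly one discriminant is a square, and it also keeps the cubic from
  having two roots, whose difference would square to \<open>d\<close>.\<close>

lemma size_proots_quartic_h_iff:
  fixes c d :: "'a::{field, finite}"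
  assumes card: "CARD('a) = 3 ^ m" and c: "c \<noteq> 0"
  shows "size (proots (quartic_h c d)) = 2 \<longleftrightarrow>
    (\<exists>r. poly (cubic_g c d) (r ^ 2) = 0 \<and> (\<forall>u. poly (cubic_g c d) u = 0 \<longrightarrow> u = r ^ 2) \<and>
      \<not> is_square (r ^ 4 - c ^ 2 * inverse (r ^ 2)))"
proof -
  note three = three_eq_0_if_CARD[OF card]
  have d: "r ^ 4 - c ^ 2 * inverse (r ^ 2) = d" if "poly (cubic_g c d) (r ^ 2) = 0" for r
  proof -
    define e where "e = c * inverse r"
    have "r ^ 4 - c ^ 2 * inverse (r ^ 2) = r ^ 4 - e ^ 2"
      unfolding e_def by (simp only: power_mult_distrib power_inverse)
    also have "\<dots> = (- (r ^ 2) + e) * (- (r ^ 2) - e)" by algebra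
    also have "\<dots> = d"
      unfolding e_def by (rule quartic_h_factorization(1)[OF three c that, symmetric])
    finally show ?thesis .
  qed
  have size: "size (proots (quartic_h c d)) = card {x. poly (quartic_h c d) x = 0}" if "d \<noteq> 0"
    by (rule size_proots_if_rsquarefree[OF rsquarefree_quartic_h[OF card that]])
  show ?thesis
  proof
    assume two: "size (proots (quartic_h c d)) = 2"
    then have d0: "d \<noteq> 0" using size_proots_quartic_h_d_0[OF three, of c] by auto
    then obtain a b where ab: "{x. poly (quartic_h c d) x = 0} = {a, b}" "a \<noteq> b"
      using two size by (auto simp: card_2_iff)
    then have roots: "poly (quartic_h c d) a = 0" "poly (quartic_h c d) b = 0" by auto
    define r where "r = a + b"
    have r: "poly (cubic_g c d) (r ^ 2) = 0"
      unfolding r_def by (rule cubic_g_root_if_two_roots_quartic_h[OF three ab(2) roots])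
    have D: "- (r ^ 2) + c * inverse r = (a - b) ^ 2"
      unfolding r_def by (rule discriminant_if_two_roots_quartic_h[OF three ab(2) roots c])
    have "\<not> is_square d"
    proof
      assume "is_square d"
      then obtain e where e: "d = e ^ 2" by (rule is_nth_powerE)
      define y where "y = e / (a - b)"
      have "e ^ 2 = (a - b) ^ 2 * (- (r ^ 2) - c * inverse r)"
        unfolding D[symmetric] e[symmetric] by (rule quartic_h_factorization(1)[OF three c r])
      then have y: "- (r ^ 2) - c * inverse r = y ^ 2"
        using ab(2) by (simp only: y_def power_divide) simp
      have "2 * y \<noteq> 0" using e d0 ab(2) two_ne_0_if_three_eq_0[OF three] by (simp add: y_def)
      then have "r + y \<noteq> r - y" by (simp add: algebra_simps flip: mult_2)
      moreover have "r + y \<in> {a, b}" "r - y \<in> {a, b}"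
        unfolding ab(1)[symmetric] mem_Collect_eq quartic_h_root_iff[OF three c r] y by simp_all
      \<comment> \<open>Distinct elements of \<open>{a, b}\<close> exhaust it, so
        \<open>2 r = a + b = r\<close>.\<close>
      ultimately have "(r + y) + (r - y) = a + b" by auto
      then have "r = 0 \<or> (2 :: 'a) = 1" unfolding r_def[symmetric] by simp
      moreover have "(2 :: 'a) \<noteq> 1" by (metis one_add_one add_cancel_right_right zero_neq_one)
      ultimately have "r = 0" by blast
      then show False using cubic_g_root_square_ne_0[OF c r] by blast
    qed
    moreover have "u = r ^ 2" if "poly (cubic_g c d) u = 0" for u
      using square_diff_roots_cubic_g[OF three _ that r] \<open>\<not> is_square d\<close> by (blast intro: is_nth_powerI)
    moreover have "\<not> is_square (r ^ 4 - c ^ 2 * inverse (r ^ 2))"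
      unfolding d[OF r] by fact
    ultimately show "\<exists>r. poly (cubic_g c d) (r ^ 2) = 0 \<and>
        (\<forall>u. poly (cubic_g c d) u = 0 \<longrightarrow> u = r ^ 2) \<and> \<not> is_square (r ^ 4 - c ^ 2 * inverse (r ^ 2))"
      using r by blast
  next
    assume "\<exists>r. poly (cubic_g c d) (r ^ 2) = 0 \<and>
        (\<forall>u. poly (cubic_g c d) u = 0 \<longrightarrow> u = r ^ 2) \<and> \<not> is_square (r ^ 4 - c ^ 2 * inverse (r ^ 2))"
    then obtain r where r: "poly (cubic_g c d) (r ^ 2) = 0"
      and "\<not> is_square (r ^ 4 - c ^ 2 * inverse (r ^ 2))" by blast
    then have nsq: "\<not> is_square d" unfolding d[OF r] by blast
    have d0: "d \<noteq> 0" using nsq by (auto intro: is_nth_powerI[of 0 0])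
    have "\<not> (is_square (- (r ^ 2) + c * inverse r) \<longleftrightarrow> is_square (- (r ^ 2) - c * inverse r))"
      using nsq unfolding quartic_h_factorization(1)[OF three c r]
      by (metis is_nth_power_mult is_square_mult_if_nonsquares)
    \<comment> \<open>Passing from \<open>r\<close> to \<open>- r\<close> exchanges the two
      discriminants, so one lemma serves both cases.\<close>
    then have "card {x. poly (quartic_h c d) x = 0} = 2"
      using card_roots_quartic_h_if_discriminant[OF three c r d0]
        card_roots_quartic_h_if_discriminant[OF three c _ d0, of "- r"] r by auto
    then show "size (proots (quartic_h c d)) = 2" using size[OF d0] by simp
  qed
qed

theorem theorem5p4:
  fixes c d :: "'a::{field, finite}" and m :: nat and g h :: "'a poly"
  assumes "m \<ge> 1" and "CARD('a) = 3 ^ m" and "c \<noteq> 0"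
    and "g = cubic_g c d" and "h = quartic_h c d"
  shows
    "(splits_into_distinct_linear_factors h \<longleftrightarrow>
        (\<exists>r1 r2 r3. distinct [r1, r2, r3] \<and>
           (\<forall>r \<in> {r1, r2, r3}. poly g (r ^ 2) = 0 \<and>
              is_square (- (r ^ 2) + c * inverse r) \<and> is_square (- (r ^ 2) - c * inverse r)))) \<and>
     ((\<exists>p1 p2. irreducible p1 \<and> irreducible p2 \<and> degree p1 = 2 \<and> degree p2 = 2 \<and> h = p1 * p2) \<longleftrightarrow>
        (\<exists>u1 u2 u3. distinct [u1, u2, u3] \<and>
           poly g u1 = 0 \<and> poly g u2 = 0 \<and> poly g u3 = 0 \<and>
           \<not> is_square u1 \<and> \<not> is_square u2 \<and>
           (\<exists>r. u3 = r ^ 2 \<and>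
              \<not> is_square (- (r ^ 2) + c * inverse r) \<and> \<not> is_square (- (r ^ 2) - c * inverse r)))) \<and>
     ((\<exists>!x. poly h x = 0) \<longleftrightarrow> irreducible g) \<and>
     (size (proots h) = 2 \<longleftrightarrow>
        (\<exists>r. poly g (r ^ 2) = 0 \<and> (\<forall>u. poly g u = 0 \<longrightarrow> u = r ^ 2) \<and>
           \<not> is_square (r ^ 4 - c ^ 2 * inverse (r ^ 2)))) \<and>
     (irreducible h \<longleftrightarrow>
        (\<exists>u. poly g u = 0 \<and> (\<forall>v. poly g v = 0 \<longrightarrow> v = u) \<and> \<not> is_square u))"
proof -
  note three = three_eq_0_if_CARD[OF assms(2)]
  show ?thesis
    unfolding assms(4,5)
    by (intro conjI splits_quartic_h_iff[OF assms(2,3)] quartic_h_irreducible_quadratics_iff[OF three assms(3)]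
        ex1_root_quartic_h_iff[OF three assms(3)] size_proots_quartic_h_iff[OF assms(2,3)]
        irreducible_quartic_h_iff[OF three assms(3)])
qed

end
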